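(* Let $0<\eta<\delta$ and let $H:\mathbb R^{3d}\times(0,\infty)^2\to\mathbb C$ be measurable and such that $$|H(u,v,w,s,t)|\lesssim\frac{t^\delta}{\max\{s,|u-w|,|v-w|\}^{2d+\delta}} .$$ If $\psi,\phi\in\mathcal S(\mathbb R^d)$, then for each $z=(w,t)\in\mathbb R^d\times(0,\infty)$ the function on $\mathbb R^d\times\mathbb R^d$ $$\nu_{w,t}(x,y)=\int_t^\infty\int_{\mathbb R^{2d}}H(u,v,w,s,t)\,\psi_{u,s}(x)\,\phi_{v,s}(y)\,\frac{du\,dv\,ds}{s}$$ satisfies $$\|(\mathsf{Sy}^1_z\mathsf{Sy}^2_z)^{-1}\nu_z\|_{\star,\eta,1}\lesssim1,$$ with implicit constant independent of $z$.
   Context: For $z=(w,t)\in\mathbb R^d\times(0,\infty)$ and $\varphi$ on $\mathbb R^d$, $\varphi_z=\varphi_{w,t}=\mathsf{Sy}_z\varphi:=t^{-d}\varphi(\frac{\cdot-w}{t})$. On functions of $(x,y)\in\mathbb R^d\times\mathbb R^d$, $\mathsf{Sy}_z^1$ and $\mathsf{Sy}_z^2$ denote this action in the variable $x$ and $y$ respectively, so $(\mathsf{Sy}^1_z\mathsf{Sy}^2_z)^{-1}\nu(x,y)=t^{2d}\nu(w+tx,w+ty)$. For $\varphi$ on $\mathbb R^{2d}$, with $\langle X\rangle=1+|X|$, $$\|\varphi\|_{\star,\eta,\delta}=\sup_{X\in\mathbb R^{2d}}\langle X\rangle^{2d+\eta}|\varphi(X)|+\sup_{X\in\mathbb R^{2d},\,0<|h|\le1}\langle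 X\rangle^{2d+\eta}\frac{|\varphi(X+h)-\varphi(X)|}{|h|^\delta}.$$ *)

theory Defs
  imports "HOL-Analysis.Analysis"
begin

text \<open>
  The symmetry action \<open>Sy z f = t^(-d) f((\<cdot> - w)/t)\<close> for \<open>z = (w,t)\<close>, \<open>t > 0\<close>, and its versions
  acting in the first and in the second variable.
\<close>

definition Sy :: "(real^'d) \<times> real \<Rightarrow> (real^'d \<Rightarrow> complex) \<Rightarrow> real^'d \<Rightarrow> complex" where
  "Sy z f = (\<lambda>x. (1 / snd z ^ CARD('d)) *\<^sub>R f ((1 / snd z) *\<^sub>R (x - fst z)))"

definition Sy1 ::
  "(real^'d) \<times> real \<Rightarrow> ((real^'d) \<times> (real^'d) \<Rightarrow> complex) \<Rightarrow> (real^'d) \<times> (real^'d) \<Rightarrow> complex" where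
  "Sy1 z \<nu> = (\<lambda>(x, y). Sy z (\<lambda>x'. \<nu> (x', y)) x)"

definition Sy2 ::
  "(real^'d) \<times> real \<Rightarrow> ((real^'d) \<times> (real^'d) \<Rightarrow> complex) \<Rightarrow> (real^'d) \<times> (real^'d) \<Rightarrow> complex" where
  "Sy2 z \<nu> = (\<lambda>(x, y). Sy z (\<lambda>y'. \<nu> (x, y')) y)"

text \<open>
  For \<open>t > 0\<close> the map \<open>Sy1 z \<circ> Sy2 z\<close> is a bijection on all functions, so that
  \<open>inv (Sy1 z \<circ> Sy2 z)\<close> is its genuine two-sided inverse, given by the expected formula.
\<close>

lemma Sy1_Sy2_apply:
  fixes w :: "real^'d"
  shows "(Sy1 (w, t) \<circ> Sy2 (w, t)) \<nu> (x, y) =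
    (1 / t ^ (2 * CARD('d))) *\<^sub>R \<nu> ((1 / t) *\<^sub>R (x - w), (1 / t) *\<^sub>R (y - w))"
  by (simp add: Sy1_def Sy2_def Sy_def mult_2 power_add)

lemma bij_Sy1_Sy2:
  fixes w :: "real^'d"
  assumes "t > 0"
  shows "bij (Sy1 (w, t) \<circ> Sy2 (w, t))"
    and "inv (Sy1 (w, t) \<circ> Sy2 (w, t)) \<nu> =
      (\<lambda>(x, y). t ^ (2 * CARD('d)) *\<^sub>R \<nu> (w + t *\<^sub>R x, w + t *\<^sub>R y))"
proof -
  define S where "S = Sy1 (w, t) \<circ> Sy2 (w, t)"
  define T :: "((real^'d) \<times> (real^'d) \<Rightarrow> complex) \<Rightarrow> (real^'d) \<times> (real^'d) \<Rightarrow> complex"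
    where "T \<nu> = (\<lambda>(x, y). t ^ (2 * CARD('d)) *\<^sub>R \<nu> (w + t *\<^sub>R x, w + t *\<^sub>R y))" for \<nu>
  have ST: "S (T \<nu>) = \<nu>" for \<nu>
  proof
    fix p :: "(real^'d) \<times> (real^'d)"
    obtain x y where p: "p = (x, y)" by (cases p)
    show "S (T \<nu>) p = \<nu> p"
      unfolding p S_def Sy1_Sy2_apply using assms by (simp add: T_def)
  qed
  have TS: "T (S \<nu>) = \<nu>" for \<nu>
  proof
    fix p :: "(real^'d) \<times> (real^'d)"
    obtain x y where p: "p = (x, y)" by (cases p)
    have "T (S \<nu>) p = t ^ (2 * CARD('d)) *\<^sub>R S \<nu> (w + t *\<^sub>R x, w + t *\<^sub>R y)"
      by (simp add: p T_def)
    also have "\<dots> = \<nu> p"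
      unfolding p S_def Sy1_Sy2_apply using assms by simp
    finally show "T (S \<nu>) p = \<nu> p" .
  qed
  show "bij (Sy1 (w, t) \<circ> Sy2 (w, t))"
    unfolding S_def[symmetric] by (rule bijI'[of S]) (metis TS, metis ST)
  show "inv (Sy1 (w, t) \<circ> Sy2 (w, t)) \<nu> =
      (\<lambda>(x, y). t ^ (2 * CARD('d)) *\<^sub>R \<nu> (w + t *\<^sub>R x, w + t *\<^sub>R y))"
    using inv_equality[of T S] ST TS by (simp add: S_def[symmetric] T_def[abs_def])
qed

text \<open>
  \<open>iter_partial [i\<^sub>1, \<dots>, i\<^sub>k] f\<close> is the iterated partial derivative
  \<open>\<partial>\<^sub>i\<^sub>1 \<dots> \<partial>\<^sub>i\<^sub>k f\<close>. Only meaningful where the lower order ones are differentiable, which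
  \<open>schwartz\<close> requires at every order; this makes \<open>f\<close> smooth, so that the words
  \<open>[i\<^sub>1, \<dots>, i\<^sub>k]\<close> describe the same derivatives as multi-indices do.
\<close>

primrec iter_partial :: "'d list \<Rightarrow> (real^'d \<Rightarrow> complex) \<Rightarrow> real^'d \<Rightarrow> complex" where
  "iter_partial [] f = f"
| "iter_partial (i # is) f = (\<lambda>x. frechet_derivative (iter_partial is f) (at x) (axis i 1))"

definition schwartz :: "(real^'d \<Rightarrow> complex) \<Rightarrow> bool" where
  "schwartz f \<longleftrightarrow>
    (\<forall>is x. iter_partial is f differentiable (at x)) \<and>
    (\<forall>is (N::nat). bounded (range (\<lambda>x. (1 + norm x) ^ N *\<^sub>R iter_partial is f x)))"

text \<open>
  The weighted Hoelder norm of a function on \<open>\<real>\<^sup>2\<^sup>d\<close>. It takes values in \<open>[0,\<infinity>]\<close>, so that a finite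
  upper bound does say that both suprema are finite.
\<close>

definition star_norm :: "real \<Rightarrow> real \<Rightarrow> ((real^'d) \<times> (real^'d) \<Rightarrow> complex) \<Rightarrow> ennreal" where
  "star_norm \<eta> \<delta> f =
    (SUP X. ennreal ((1 + norm X) powr (2 * real CARD('d) + \<eta>) * norm (f X))) +
    (SUP (X, h) \<in> UNIV \<times> {h. 0 < norm h \<and> norm h \<le> 1}.
       ennreal ((1 + norm X) powr (2 * real CARD('d) + \<eta>) * (norm (f (X + h) - f X) / norm h powr \<delta>)))"

definition nu_integrand ::
  "(real^'d \<Rightarrow> real^'d \<Rightarrow> real^'d \<Rightarrow> real \<Rightarrow> real \<Rightarrow> complex) \<Rightarrow> (real^'d \<Rightarrow> complex) \<Rightarrow>
    (real^'d \<Rightarrow> complex) \<Rightarrow> (real^'d) \<times> real \<Rightarrow> real^'d \<Rightarrow> real^'d \<Rightarrow>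
    real^'d \<Rightarrow> real^'d \<Rightarrow> real \<Rightarrow> complex" where
  "nu_integrand H \<psi> \<phi> z x y u v s = H u v (fst z) s (snd z) * Sy (u, s) \<psi> x * Sy (v, s) \<phi> y"

definition nu ::
  "(real^'d \<Rightarrow> real^'d \<Rightarrow> real^'d \<Rightarrow> real \<Rightarrow> real \<Rightarrow> complex) \<Rightarrow> (real^'d \<Rightarrow> complex) \<Rightarrow>
    (real^'d \<Rightarrow> complex) \<Rightarrow> (real^'d) \<times> real \<Rightarrow> (real^'d) \<times> (real^'d) \<Rightarrow> complex" where
  "nu H \<psi> \<phi> z = (\<lambda>(x, y).
     LINT s:{snd z<..}|lborel. (1 / s) *\<^sub>R (LINT (u, v)|lborel. nu_integrand H \<psi> \<phi> z x y u v s))"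

end

theory Submission
  imports Defs
begin

text \<open>
  Write \<open>d\<close> for the dimension, \<open>a = (x - u)/s\<close>, \<open>b = (y - v)/s\<close> and
  \<open>M = max {s, |u - w|, |v - w|}\<close>. By the triangle inequality the point \<open>(x, y)\<close> can be further from
  \<open>(w, w)\<close> than \<open>(u, v)\<close> only at the cost of factors in \<open>a\<close> and \<open>b\<close>:
  \<open>max {s, |x - w|, |y - w|} \<le> M (1 + |a|)(1 + |b|)\<close>. For \<open>s > t\<close> the left-hand side dominates
  both \<open>s\<close> and \<open>m = max {t, |x - w|, |y - w|}\<close>. Splitting the exponent \<open>2d + \<delta>\<close> of the kernel
  as \<open>(2d + \<eta>) + (\<delta> - \<eta>)\<close>, the first part is spent on \<open>m\<close> and the second on \<open>s\<close>:
  \<open>M^-(2d+\<delta>) \<le> m^-(2d+\<eta>) s^-(\<delta>-\<eta>) ((1 + |a|)(1 + |b|))^(2d+\<delta>)\<close>.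
  The factors in \<open>a\<close> and \<open>b\<close> are absorbed by the Schwartz functions, leaving integrable weights in
  \<open>u\<close> and \<open>v\<close> whose integrals do not depend on \<open>s\<close>, while
  \<open>\<integral> s^-(\<delta>-\<eta>) ds/s\<close> over \<open>s > t\<close> equals \<open>t^-(\<delta>-\<eta>)/(\<delta>-\<eta>)\<close>; this is where \<open>\<eta> < \<delta>\<close> enters.
  The pointwise part is \<open>kernel_bound\<close>, the integral part is \<open>integral_envelope\<close>, and the powers of
  \<open>t\<close> cancel in \<open>rescaled_constant_bound\<close>.

  For the Lipschitz part, moving \<open>(x, y)\<close> by \<open>t h\<close> moves \<open>(a, b)\<close> by \<open>(t/s) h\<close>, which is no longer
  than \<open>h\<close> because \<open>s > t\<close>. Since products of Schwartz functions are Lipschitz with rapidly decaying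
  constants (\<open>schwartz_product_lipschitz_decay\<close>), the difference of the two integrands satisfies the
  hypothesis of \<open>kernel_bound\<close> with an additional factor \<open>|h|\<close>, and the same estimate applies.
\<close>

section \<open>The integrable majorant\<close>

text \<open>
  The primitive \<open>arctan\<close> is bounded; the two half-lines are exchanged by reflection.
\<close>

lemma nn_integral_inverse_1_plus_square_finite:
  "(\<integral>\<^sup>+x. ennreal (1 / (1 + x\<^sup>2)) \<partial>(lborel :: real measure)) < \<infinity>"
proof -
  let ?f = "\<lambda>x::real. 1 / (1 + x\<^sup>2)"
  have half: "(\<integral>\<^sup>+x. ennreal (?f x) * indicator {0..} x \<partial>lborel) = ennreal (pi / 2 - arctan 0)"
  proof (rule nn_integral_FTC_atLeast)
    show "(arctan has_real_derivative ?f x) (at x)" for x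
      using DERIV_arctan[of x] by (simp add: inverse_eq_divide)
    show "(arctan \<longlongrightarrow> pi / 2) at_top"
      by (rule tendsto_arctan_at_top)
  qed auto
  have "(\<integral>\<^sup>+x. ennreal (?f x) \<partial>lborel)
      \<le> (\<integral>\<^sup>+x. ennreal (?f x) * indicator {0..} x
             + ennreal (?f (0 + (-1) * x)) * indicator {0..} (0 + (-1) * x) \<partial>lborel)"
    by (intro nn_integral_mono) (auto split: split_indicator)
  also have "\<dots> = (\<integral>\<^sup>+x. ennreal (?f x) * indicator {0..} x \<partial>lborel)
      + (\<integral>\<^sup>+x. ennreal (?f (0 + (-1) * x)) * indicator {0..} (0 + (-1) * x) \<partial>lborel)"
    by (intro nn_integral_add) auto
  also have "(\<integral>\<^sup>+x. ennreal (?f (0 + (-1) * x)) * indicator {0..} (0 + (-1) * x) \<partial>lborel)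
      = (\<integral>\<^sup>+x. ennreal (?f x) * indicator {0..} x \<partial>lborel)"
    using nn_integral_real_affine[of "\<lambda>x. ennreal (?f x) * indicator {0..} x" "-1" 0] by simp
  finally have "(\<integral>\<^sup>+x. ennreal (?f x) \<partial>lborel) \<le> ennreal (pi / 2) + ennreal (pi / 2)"
    unfolding half by simp
  also have "\<dots> < \<infinity>"
    by simp
  finally show ?thesis .
qed

text \<open>
  Comparison with a tensor product reduces integrability of the radial weight in dimension \<open>d\<close>
  to the one-dimensional integral of \<open>1 / (1 + x\<^sup>2)\<close>, without polar coordinates. The exponent is
  \<open>2d\<close> instead of the optimal \<open>d + \<epsilon>\<close>, which is harmless against Schwartz decay.
\<close>

lemma weight_le_prod:
  fixes a :: "'a::euclidean_space"
  shows "(1 + norm a) powr (- (2 * real DIM('a))) \<le> (\<Prod>b\<in>Basis. 1 / (1 + (a \<bullet> b)\<^sup>2))"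
proof -
  have "1 + (a \<bullet> b)\<^sup>2 \<le> (1 + norm a)\<^sup>2" if "b \<in> Basis" for b
  proof -
    have "(a \<bullet> b)\<^sup>2 \<le> (norm a)\<^sup>2"
      using Basis_le_norm[OF that, of a] by (metis abs_ge_zero power2_abs power_mono)
    then show ?thesis by (simp add: power2_sum add_increasing2)
  qed
  then have "(\<Prod>b\<in>Basis. 1 + (a \<bullet> b)\<^sup>2) \<le> (\<Prod>b\<in>(Basis::'a set). (1 + norm a)\<^sup>2)"
    by (intro prod_mono) auto
  also have "\<dots> = (1 + norm a) ^ (2 * DIM('a))"
    by (simp add: power_mult)
  also have "\<dots> = (1 + norm a) powr (2 * real DIM('a))"
    by (subst powr_realpow[symmetric]) (auto simp: add_pos_nonneg)
  finally have le: "(\<Prod>b\<in>Basis. 1 + (a \<bullet> b)\<^sup>2) \<le> (1 + norm a) powr (2 * real DIM('a))" .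
  have "0 < (\<Prod>b\<in>(Basis::'a set). 1 + (a \<bullet> b)\<^sup>2)"
    by (intro prod_pos) (auto simp: add_pos_nonneg)
  with le have "inverse ((1 + norm a) powr (2 * real DIM('a))) \<le> inverse (\<Prod>b\<in>Basis. 1 + (a \<bullet> b)\<^sup>2)"
    by (rule le_imp_inverse_le)
  then show ?thesis
    by (simp add: powr_minus prod_dividef inverse_eq_divide)
qed

lemma nn_integral_weight_finite:
  "(\<integral>\<^sup>+a. ennreal ((1 + norm a) powr (- (2 * real DIM('a)))) \<partial>(lborel :: 'a::euclidean_space measure)) < \<infinity>"
proof -
  have "(\<integral>\<^sup>+a. ennreal ((1 + norm a) powr (- (2 * real DIM('a)))) \<partial>(lborel :: 'a measure))
      \<le> (\<integral>\<^sup>+a. (\<Prod>b\<in>Basis. ennreal (1 / (1 + (a \<bullet> b)\<^sup>2))) \<partial>(lborel :: 'a measure))"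
    by (intro nn_integral_mono) (auto simp: prod_ennreal intro!: ennreal_leI weight_le_prod)
  also have "\<dots> = (\<Prod>b\<in>(Basis :: 'a set). \<integral>\<^sup>+x. ennreal (1 / (1 + x\<^sup>2)) \<partial>lborel)"
    by (intro nn_integral_lborel_prod) auto
  also have "\<dots> < \<infinity>"
    using nn_integral_inverse_1_plus_square_finite
    by (simp add: power_less_top_ennreal)
  finally show ?thesis .
qed

text \<open>
  The dilate of the weight \<open>(1 + |a|)^(-2d)\<close> to scale \<open>s\<close>, centred at \<open>x\<close> and scaled so that the
  integral in \<open>u\<close> is the same for all \<open>s > 0\<close> and all \<open>x\<close>.
\<close>

definition rescaled_weight :: "real \<Rightarrow> 'a::euclidean_space \<Rightarrow> 'a \<Rightarrow> real" where
  "rescaled_weight s x u =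
     (1 / s ^ DIM('a)) * (1 + norm ((1 / s) *\<^sub>R (x - u))) powr (- (2 * real DIM('a)))"

lemma measurable_rescaled_weight [measurable (raw)]:
  assumes [measurable]: "f \<in> borel_measurable M" "g \<in> borel_measurable M" "h \<in> borel_measurable M"
  shows "(\<lambda>z. rescaled_weight (f z) (g z) (h z)) \<in> borel_measurable M"
  unfolding rescaled_weight_def by measurable

lemma rescaled_weight_nonneg: "0 < s \<Longrightarrow> 0 \<le> rescaled_weight s x u"
  by (simp add: rescaled_weight_def)

lemma nn_integral_rescaled_weight:
  fixes x :: "'a::euclidean_space"
  assumes "0 < s"
  shows "(\<integral>\<^sup>+u. ennreal (rescaled_weight s x u) \<partial>lborel) =
    (\<integral>\<^sup>+a. ennreal ((1 + norm a) powr (- (2 * real DIM('a)))) \<partial>(lborel :: 'a measure))"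
proof -
  have lb: "(lborel :: 'a measure) = density (distr lborel borel (\<lambda>a. x + (- s) *\<^sub>R a)) (\<lambda>_. \<bar>- s\<bar> ^ DIM('a))"
    using assms by (intro lborel_affine) auto
  have "(\<integral>\<^sup>+u. ennreal (rescaled_weight s x u) \<partial>lborel)
      = (\<integral>\<^sup>+a. ennreal (s ^ DIM('a)) * ennreal (rescaled_weight s x (x + (- s) *\<^sub>R a)) \<partial>lborel)"
    using assms by (subst lb) (simp add: nn_integral_density nn_integral_distr)
  also have "\<dots> = (\<integral>\<^sup>+a. ennreal ((1 + norm a) powr (- (2 * real DIM('a)))) \<partial>(lborel :: 'a measure))"
    using assms by (intro nn_integral_cong) (simp add: rescaled_weight_def ennreal_mult[symmetric])
  finally show ?thesis .
qed

lemma nn_integral_lborel_pair: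
  assumes [measurable]: "f \<in> borel_measurable borel"
  shows "(\<integral>\<^sup>+z. f z \<partial>(lborel :: ('a::euclidean_space \<times> 'b::euclidean_space) measure))
    = (\<integral>\<^sup>+x. \<integral>\<^sup>+y. f (x, y) \<partial>lborel \<partial>lborel)"
  using lborel.nn_integral_fst[of f "lborel :: 'a measure"] by (simp add: lborel_prod)

text \<open>
  The majorant of the integrand, up to a factor that does not depend on \<open>u\<close>, \<open>v\<close>, \<open>s\<close>. The extra
  power \<open>s^(-1)\<close> comes from the measure \<open>ds/s\<close>, and \<open>\<alpha>\<close> will be \<open>\<delta> - \<eta>\<close>.
\<close>

definition envelope ::
  "real \<Rightarrow> real \<Rightarrow> 'a::euclidean_space \<Rightarrow> 'a \<Rightarrow> 'a \<Rightarrow> 'a \<Rightarrow> real \<Rightarrow> real" where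
  "envelope \<alpha> t x y u v s =
     indicator {t<..} s * s powr (- \<alpha> - 1) * (rescaled_weight s x u * rescaled_weight s y v)"

lemma measurable_envelope [measurable (raw)]:
  assumes [measurable]: "f \<in> borel_measurable M" "g \<in> borel_measurable M" "h \<in> borel_measurable M"
  shows "(\<lambda>z. envelope \<alpha> t x y (f z) (g z) (h z)) \<in> borel_measurable M"
  unfolding envelope_def by measurable

lemma envelope_nonneg: "0 < t \<Longrightarrow> 0 \<le> envelope \<alpha> t x y u v s"
  by (auto simp: envelope_def rescaled_weight_nonneg split: split_indicator)

lemma nn_integral_powr_tail:
  assumes "0 < \<alpha>" "0 < t"
  shows "(\<integral>\<^sup>+s. ennreal (indicator {t<..} s * s powr (- \<alpha> - 1)) \<partial>lborel) = ennreal (t powr (- \<alpha>) / \<alpha>)"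
proof -
  have "((\<lambda>s. s powr (- \<alpha> - 1)) has_integral (- (t powr (- \<alpha> - 1 + 1)) / (- \<alpha> - 1 + 1))) {t..}"
    using assms by (intro has_integral_powr_to_inf) auto
  then have "(\<integral>\<^sup>+s. ennreal (indicator {t..} s * s powr (- \<alpha> - 1)) \<partial>lborel)
      = ennreal (- (t powr (- \<alpha> - 1 + 1)) / (- \<alpha> - 1 + 1))"
    by (intro nn_integral_has_integral_lebesgue) auto
  also have "\<dots> = ennreal (t powr (- \<alpha>) / \<alpha>)"
    by simp
  also have "(\<integral>\<^sup>+s. ennreal (indicator {t..} s * s powr (- \<alpha> - 1)) \<partial>lborel)
      = (\<integral>\<^sup>+s. ennreal (indicator {t<..} s * s powr (- \<alpha> - 1)) \<partial>lborel)"
    by (intro nn_integral_cong_AE eventually_mono[OF AE_lborel_singleton[of t]])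
       (auto split: split_indicator)
  finally show ?thesis .
qed

text \<open>
  Tonelli in two orders of the variables: with \<open>s\<close> outermost, as in the iterated integral defining
  \<open>nu\<close>, and with \<open>s\<close> innermost, as in the absolute convergence claim. In both cases the integrals
  over \<open>u\<close> and \<open>v\<close> are carried out first.
\<close>

lemma nn_integral_weighted_product:
  fixes k :: "real \<Rightarrow> ennreal" and f g :: "real \<Rightarrow> 'a::euclidean_space \<Rightarrow> ennreal"
  assumes k [measurable]: "k \<in> borel_measurable borel"
    and f [measurable]: "case_prod f \<in> borel_measurable (borel \<Otimes>\<^sub>M borel)"
    and g [measurable]: "case_prod g \<in> borel_measurable (borel \<Otimes>\<^sub>M borel)"
    and F: "\<And>s. (\<integral>\<^sup>+u. f s u \<partial>lborel) = F s" and G: "\<And>s. (\<integral>\<^sup>+v. g s v \<partial>lborel) = G s"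
  shows "(\<integral>\<^sup>+(s, u, v). k s * (f s u * g s v) \<partial>lborel) = (\<integral>\<^sup>+s. k s * (F s * G s) \<partial>lborel)"
    and "(\<integral>\<^sup>+(u, v, s). k s * (f s u * g s v) \<partial>lborel) = (\<integral>\<^sup>+s. k s * (F s * G s) \<partial>lborel)"
proof -
  have inner: "(\<integral>\<^sup>+u. \<integral>\<^sup>+v. k s * (f s u * g s v) \<partial>lborel \<partial>lborel) = k s * (F s * G s)" for s
  proof -
    have "(\<integral>\<^sup>+v. k s * (f s u * g s v) \<partial>lborel) = k s * f s u * G s" for u
      unfolding G[symmetric] mult.assoc[symmetric] by (rule nn_integral_cmult) measurable
    moreover have "(\<integral>\<^sup>+u. (k s * G s) * f s u \<partial>lborel) = (k s * G s) * F s"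
      unfolding F[symmetric] by (rule nn_integral_cmult) measurable
    ultimately show ?thesis
      by (simp add: mult_ac)
  qed
  have pair1: "(\<integral>\<^sup>+(u, v). k s * (f s u * g s v) \<partial>lborel)
      = (\<integral>\<^sup>+u. \<integral>\<^sup>+v. k s * (f s u * g s v) \<partial>lborel \<partial>lborel)" for s
  proof -
    have "(\<lambda>(u, v). k s * (f s u * g s v)) \<in> borel_measurable borel"
      unfolding borel_prod[symmetric] by measurable
    from nn_integral_lborel_pair[OF this] show ?thesis
      by simp
  qed
  have pair2: "(\<integral>\<^sup>+(v, s). k s * (f s u * g s v) \<partial>lborel)
      = (\<integral>\<^sup>+v. \<integral>\<^sup>+s. k s * (f s u * g s v) \<partial>lborel \<partial>lborel)" for u
  proof -
    have "(\<lambda>(v, s). k s * (f s u * g s v)) \<in> borel_measurable borel"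
      unfolding borel_prod[symmetric] by measurable
    from nn_integral_lborel_pair[OF this] show ?thesis
      by simp
  qed
  have "(\<integral>\<^sup>+(s, u, v). k s * (f s u * g s v) \<partial>lborel)
      = (\<integral>\<^sup>+s. \<integral>\<^sup>+z. (case (s, z) of (s, u, v) \<Rightarrow> k s * (f s u * g s v)) \<partial>lborel \<partial>lborel)"
    by (rule nn_integral_lborel_pair) (unfold borel_prod[symmetric], measurable)
  also have "\<dots> = (\<integral>\<^sup>+s. \<integral>\<^sup>+u. \<integral>\<^sup>+v. k s * (f s u * g s v) \<partial>lborel \<partial>lborel \<partial>lborel)"
    by (simp add: pair1)
  finally show "(\<integral>\<^sup>+(s, u, v). k s * (f s u * g s v) \<partial>lborel) = (\<integral>\<^sup>+s. k s * (F s * G s) \<partial>lborel)"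
    unfolding inner .
  have "(\<integral>\<^sup>+(u, v, s). k s * (f s u * g s v) \<partial>lborel)
      = (\<integral>\<^sup>+u. \<integral>\<^sup>+z. (case (u, z) of (u, v, s) \<Rightarrow> k s * (f s u * g s v)) \<partial>lborel \<partial>lborel)"
    by (rule nn_integral_lborel_pair) (unfold borel_prod[symmetric], measurable)
  also have "\<dots> = (\<integral>\<^sup>+u. \<integral>\<^sup>+v. \<integral>\<^sup>+s. k s * (f s u * g s v) \<partial>lborel \<partial>lborel \<partial>lborel)"
    by (simp add: pair2)
  also have "\<dots> = (\<integral>\<^sup>+u. \<integral>\<^sup>+s. \<integral>\<^sup>+v. k s * (f s u * g s v) \<partial>lborel \<partial>lborel \<partial>lborel)"
    by (intro nn_integral_cong lborel_pair.Fubini') measurable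
  also have "\<dots> = (\<integral>\<^sup>+s. \<integral>\<^sup>+u. \<integral>\<^sup>+v. k s * (f s u * g s v) \<partial>lborel \<partial>lborel \<partial>lborel)"
    by (intro lborel_pair.Fubini') measurable
  finally show "(\<integral>\<^sup>+(u, v, s). k s * (f s u * g s v) \<partial>lborel) = (\<integral>\<^sup>+s. k s * (F s * G s) \<partial>lborel)"
    unfolding inner .
qed

text \<open>
  The two spatial integrals contribute the same constant at every scale because the dilation
  preserves them, so only the integral of \<open>s powr (- \<alpha> - 1)\<close> over \<open>s > t\<close> depends on \<open>t\<close>.
\<close>

lemma nn_integral_envelope:
  fixes x y :: "'a::euclidean_space"
  assumes "0 < \<alpha>" "0 < t"
  defines "W \<equiv> (\<integral>\<^sup>+a. ennreal ((1 + norm a) powr (- (2 * real DIM('a)))) \<partial>(lborel :: 'a measure))"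
  shows "(\<integral>\<^sup>+(s, u, v). ennreal (envelope \<alpha> t x y u v s) \<partial>lborel) = W * W * ennreal (t powr (- \<alpha>) / \<alpha>)"
    and "(\<integral>\<^sup>+(u, v, s). ennreal (envelope \<alpha> t x y u v s) \<partial>lborel) = W * W * ennreal (t powr (- \<alpha>) / \<alpha>)"
proof -
  define k where "k s = ennreal (indicator {t<..} s * s powr (- \<alpha> - 1))" for s :: real
  \<comment> \<open>The cutoff is repeated in \<open>\<rho>\<close> so that its integral is known for every real \<open>s\<close>, also \<open>s \<le> 0\<close>.\<close>
  define \<rho> where "\<rho> z s u = ennreal (indicator {t<..} s * rescaled_weight s z u)" for z s and u :: 'a
  have [measurable]: "k \<in> borel_measurable borel"
    unfolding k_def by measurable
  have split: "ennreal (envelope \<alpha> t x y u v s) = k s * (\<rho> x s u * \<rho> y s v)" for u v s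
  proof (cases "t < s")
    case True
    then have "0 \<le> rescaled_weight s x u" "0 \<le> rescaled_weight s y v"
      using assms(2) by (simp_all add: rescaled_weight_nonneg)
    with True show ?thesis
      by (simp add: k_def \<rho>_def envelope_def ennreal_mult)
  qed (simp add: k_def envelope_def)
  have \<rho>: "(\<integral>\<^sup>+u. \<rho> z s u \<partial>lborel) = indicator {t<..} s * W" for z s
    using assms(2) by (auto simp: \<rho>_def W_def nn_integral_rescaled_weight split: split_indicator)
  have k: "(\<integral>\<^sup>+s. k s * (indicator {t<..} s * W * (indicator {t<..} s * W)) \<partial>lborel) = W * W * ennreal (t powr (- \<alpha>) / \<alpha>)"
  proof -
    have "(\<integral>\<^sup>+s. k s * (indicator {t<..} s * W * (indicator {t<..} s * W)) \<partial>lborel) = (\<integral>\<^sup>+s. (W * W) * k s \<partial>lborel)"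
      by (intro nn_integral_cong) (auto simp: k_def mult_ac split: split_indicator)
    also have "\<dots> = (W * W) * (\<integral>\<^sup>+s. k s \<partial>lborel)"
      by (rule nn_integral_cmult) auto
    finally show ?thesis
      unfolding k_def nn_integral_powr_tail[OF assms(1,2)] .
  qed
  have meas: "k \<in> borel_measurable borel"
      "case_prod (\<rho> x) \<in> borel_measurable (borel \<Otimes>\<^sub>M borel)"
      "case_prod (\<rho> y) \<in> borel_measurable (borel \<Otimes>\<^sub>M borel)"
    unfolding k_def \<rho>_def by measurable
  show "(\<integral>\<^sup>+(s, u, v). ennreal (envelope \<alpha> t x y u v s) \<partial>lborel) = W * W * ennreal (t powr (- \<alpha>) / \<alpha>)"
    unfolding split nn_integral_weighted_product(1)[OF meas \<rho> \<rho>] k ..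
  show "(\<integral>\<^sup>+(u, v, s). ennreal (envelope \<alpha> t x y u v s) \<partial>lborel) = W * W * ennreal (t powr (- \<alpha>) / \<alpha>)"
    unfolding split nn_integral_weighted_product(2)[OF meas \<rho> \<rho>] k ..
qed

lemma integral_envelope:
  fixes x y :: "'a::euclidean_space"
  assumes "0 < \<alpha>" "0 < t"
  defines "W \<equiv> LINT a|(lborel :: 'a measure). (1 + norm a) powr (- (2 * real DIM('a)))"
  shows "integrable lborel (\<lambda>(s, u, v). envelope \<alpha> t x y u v s)"
    and "integrable lborel (\<lambda>(u, v, s). envelope \<alpha> t x y u v s)"
    and "(LINT (s, u, v)|lborel. envelope \<alpha> t x y u v s) = W\<^sup>2 * (t powr (- \<alpha>) / \<alpha>)"
proof -
  let ?w = "\<lambda>a::'a. (1 + norm a) powr (- (2 * real DIM('a)))"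
  have "integrable lborel ?w"
    using nn_integral_weight_finite by (intro integrableI_nonneg) auto
  then have W: "(\<integral>\<^sup>+a. ennreal (?w a) \<partial>lborel) = ennreal W" "0 \<le> W"
    unfolding W_def by (auto intro: nn_integral_eq_integral)
  have W2: "ennreal W * ennreal W * ennreal (t powr (- \<alpha>) / \<alpha>) = ennreal (W\<^sup>2 * (t powr (- \<alpha>) / \<alpha>))"
  proof -
    have "ennreal r * ennreal r * ennreal c = ennreal (r\<^sup>2 * c)" if "0 \<le> r" "0 \<le> c" for r c
      using that by (simp add: ennreal_mult power2_eq_square)
    then show ?thesis
      using W(2) assms(1) by simp
  qed
  note E = nn_integral_envelope[OF assms(1,2), of x y, unfolded W(1) W2]
  have "(\<lambda>(s, u, v). envelope \<alpha> t x y u v s) \<in> borel_measurable borel"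
    unfolding borel_prod[symmetric] by measurable
  then have m1: "(\<lambda>(s, u, v). envelope \<alpha> t x y u v s) \<in> borel_measurable lborel"
    by simp
  have "(\<lambda>(u, v, s). envelope \<alpha> t x y u v s) \<in> borel_measurable borel"
    unfolding borel_prod[symmetric] by measurable
  then have m2: "(\<lambda>(u, v, s). envelope \<alpha> t x y u v s) \<in> borel_measurable lborel"
    by simp
  show I1: "integrable lborel (\<lambda>(s, u, v). envelope \<alpha> t x y u v s)"
    using E(1) assms(2)
    by (intro integrableI_nonneg m1) (auto simp: envelope_nonneg case_prod_unfold)
  show "integrable lborel (\<lambda>(u, v, s). envelope \<alpha> t x y u v s)"
    using E(2) assms(2)
    by (intro integrableI_nonneg m2) (auto simp: envelope_nonneg case_prod_unfold)
  show "(LINT (s, u, v)|lborel. envelope \<alpha> t x y u v s) = W\<^sup>2 * (t powr (- \<alpha>) / \<alpha>)"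
    using E(1) assms W(2)
    by (intro integral_eq_nn_integral[OF m1, THEN trans]) (auto simp: envelope_nonneg case_prod_unfold)
qed

section \<open>Decay and Lipschitz bounds for Schwartz functions\<close>

text \<open>
  The weights \<open>(1 + |a|)^(-r)\<close> vary slowly: a translation by at most \<open>1\<close> changes \<open>1 + |a|\<close> by at
  most a factor \<open>2\<close>.
\<close>

lemma weight_shift:
  fixes a b :: "'a::real_normed_vector"
  assumes "norm (a - b) \<le> 1" and "0 \<le> r"
  shows "(1 + norm b) powr (- r) \<le> 2 powr r * (1 + norm a) powr (- r)"
proof -
  have "norm a \<le> norm b + 1"
    using norm_triangle_ineq2[of a b] assms(1) by linarith
  then have "1 + norm a \<le> 2 * (1 + norm b)"
    by (smt (verit) norm_ge_zero)
  then have "(1 + norm a) powr r \<le> (2 * (1 + norm b)) powr r"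
    using assms(2) by (intro powr_mono2) auto
  also have "\<dots> = 2 powr r * (1 + norm b) powr r"
    by (rule powr_mult)
  finally have "(1 + norm a) powr r \<le> 2 powr r * (1 + norm b) powr r" .
  moreover have "0 < 1 + norm a" "0 < 1 + norm b"
    by (simp_all add: add_pos_nonneg)
  ultimately show ?thesis
    by (simp add: powr_minus field_simps)
qed

lemma schwartz_iter_partial_decay:
  assumes "schwartz f"
  shows "\<exists>B\<ge>0. \<forall>a. norm (iter_partial is f a) \<le> B * (1 + norm a) powr (- r)"
proof -
  define N where "N = nat \<lceil>r\<rceil>"
  have N: "r \<le> real N"
    unfolding N_def by linarith
  obtain B where B: "norm ((1 + norm a) ^ N *\<^sub>R iter_partial is f a) \<le> B" for a
    using assms unfolding schwartz_def bounded_iff by blast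
  have "0 \<le> B"
    using B[of 0] norm_ge_zero order_trans by blast
  moreover have "norm (iter_partial is f a) \<le> B * (1 + norm a) powr (- r)" for a
  proof -
    have pos: "0 < 1 + norm a"
      by (simp add: add_pos_nonneg)
    have "(1 + norm a) powr r * norm (iter_partial is f a)
        \<le> (1 + norm a) powr real N * norm (iter_partial is f a)"
      using N by (intro mult_right_mono powr_mono) auto
    also have "\<dots> \<le> B"
      using B[of a] pos by (simp add: powr_realpow)
    finally show ?thesis
      using pos by (simp add: powr_minus field_simps)
  qed
  ultimately show ?thesis by blast
qed

lemma schwartz_decay:
  assumes "schwartz f"
  shows "\<exists>B\<ge>0. \<forall>a. norm (f a) \<le> B * (1 + norm a) powr (- r)"
  using schwartz_iter_partial_decay[OF assms, of "[]"] by simp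

lemma schwartz_imp_continuous:
  assumes "schwartz f"
  shows "continuous_on UNIV f"
proof -
  have "iter_partial [] f differentiable (at x)" for x
    using assms unfolding schwartz_def by blast
  then show ?thesis
    by (auto intro!: continuous_at_imp_continuous_on differentiable_imp_continuous_within)
qed

text \<open>
  The derivative is bounded by the sum of the norms of the partial derivatives, hence decays at any rate; along
  a segment of length at most \<open>1\<close> this decay is uniform by \<open>weight_shift\<close>, and the mean value
  inequality applies.
\<close>

lemma schwartz_lipschitz_decay:
  fixes f :: "real^'d \<Rightarrow> complex"
  assumes "schwartz f" and "0 \<le> r"
  shows "\<exists>L\<ge>0. \<forall>a h. norm h \<le> 1 \<longrightarrow> norm (f (a + h) - f a) \<le> L * norm h * (1 + norm a) powr (- r)"
proof -
  have diff: "f differentiable (at x)" for x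
    using assms(1) unfolding schwartz_def by (metis iter_partial.simps(1))
  let ?D = "\<lambda>x. frechet_derivative f (at x)"
  have "\<exists>B\<ge>0. \<forall>a. norm (?D a (axis i 1)) \<le> B * (1 + norm a) powr (- r)" for i
    using schwartz_iter_partial_decay[OF assms(1), of "[i]" r] by simp
  then obtain B where B: "\<And>i. 0 \<le> B i"
      "\<And>i a. norm (?D a (axis i 1)) \<le> B i * (1 + norm a) powr (- r)"
    by metis
  define S where "S = (\<Sum>i\<in>UNIV. B i)"
  have S: "0 \<le> S"
    unfolding S_def using B(1) by (simp add: sum_nonneg)
  have onorm: "onorm (?D x) \<le> S * (1 + norm x) powr (- r)" for x
  proof (rule onorm_le)
    fix v :: "real^'d"
    have lin: "linear (?D x)"
      using diff[of x] frechet_derivative_works has_derivative_linear by blast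
    have "?D x v = ?D x (\<Sum>i\<in>UNIV. v $ i *\<^sub>R axis i 1)"
      using basis_expansion[of v] by (simp add: scalar_mult_eq_scaleR)
    also have "\<dots> = (\<Sum>i\<in>UNIV. v $ i *\<^sub>R ?D x (axis i 1))"
      by (simp add: linear_sum[OF lin] linear_scale[OF lin])
    finally have "norm (?D x v) \<le> (\<Sum>i\<in>UNIV. norm (v $ i *\<^sub>R ?D x (axis i 1)))"
      using norm_sum by metis
    also have "\<dots> \<le> (\<Sum>i\<in>UNIV. norm v * (B i * (1 + norm x) powr (- r)))"
      unfolding norm_scaleR
      by (intro sum_mono mult_mono B) (auto simp: component_le_norm_cart)
    also have "\<dots> = S * (1 + norm x) powr (- r) * norm v"
      by (simp add: S_def sum_distrib_left sum_distrib_right mult_ac)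
    finally show "norm (?D x v) \<le> S * (1 + norm x) powr (- r) * norm v" .
  qed
  have "norm (f (a + h) - f a) \<le> (S * 2 powr r) * norm h * (1 + norm a) powr (- r)"
    if "norm h \<le> 1" for a h
  proof -
    have "norm (f (a + h) - f a) \<le> S * (2 powr r * (1 + norm a) powr (- r)) * norm ((a + h) - a)"
    proof (rule differentiable_bound[where f' = ?D and S = "closed_segment a (a + h)"])
      fix x assume x: "x \<in> closed_segment a (a + h)"
      show "(f has_derivative ?D x) (at x within closed_segment a (a + h))"
        using diff[of x] frechet_derivative_works has_derivative_at_withinI by blast
      have "norm (a - x) \<le> 1"
        using segment_bound1[OF x] that by (simp add: norm_minus_commute)
      then have "S * (1 + norm x) powr (- r) \<le> S * (2 powr r * (1 + norm a) powr (- r))"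
        using S assms(2) by (intro mult_left_mono weight_shift) auto
      with onorm[of x] show "onorm (?D x) \<le> S * (2 powr r * (1 + norm a) powr (- r))"
        by linarith
    qed auto
    then show ?thesis by (simp add: mult_ac)
  qed
  moreover have "0 \<le> S * 2 powr r"
    using S by simp
  ultimately show ?thesis by blast
qed

text \<open>
  One factor is varied at a time. The common bound \<open>\<epsilon>\<close> for both displacements is what allows the
  norm of the full increment in \<open>\<real>\<^sup>2\<^sup>d\<close> to be used.
\<close>

lemma schwartz_product_lipschitz_decay:
  fixes \<psi> \<phi> :: "real^'d \<Rightarrow> complex"
  assumes "schwartz \<psi>" and "schwartz \<phi>" and "0 \<le> r"
  shows "\<exists>L\<ge>0. \<forall>a b h k \<epsilon>. norm h \<le> \<epsilon> \<longrightarrow> norm k \<le> \<epsilon> \<longrightarrow> \<epsilon> \<le> 1 \<longrightarrow>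
    norm (\<psi> (a + h) * \<phi> (b + k) - \<psi> a * \<phi> b)
      \<le> L * \<epsilon> * (1 + norm a) powr (- r) * (1 + norm b) powr (- r)"
proof -
  obtain A where A: "0 \<le> A" "\<And>a. norm (\<psi> a) \<le> A * (1 + norm a) powr (- r)"
    using schwartz_decay[OF assms(1)] by metis
  obtain B where B: "0 \<le> B" "\<And>a. norm (\<phi> a) \<le> B * (1 + norm a) powr (- r)"
    using schwartz_decay[OF assms(2)] by metis
  obtain A' where A': "0 \<le> A'"
      "\<And>a h. norm h \<le> 1 \<Longrightarrow> norm (\<psi> (a + h) - \<psi> a) \<le> A' * norm h * (1 + norm a) powr (- r)"
    using schwartz_lipschitz_decay[OF assms(1,3)] by metis
  obtain B' where B': "0 \<le> B'"
      "\<And>a h. norm h \<le> 1 \<Longrightarrow> norm (\<phi> (a + h) - \<phi> a) \<le> B' * norm h * (1 + norm a) powr (- r)"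
    using schwartz_lipschitz_decay[OF assms(2,3)] by metis
  have "norm (\<psi> (a + h) * \<phi> (b + k) - \<psi> a * \<phi> b)
      \<le> (A' * (B * 2 powr r) + A * B') * \<epsilon> * (1 + norm a) powr (- r) * (1 + norm b) powr (- r)"
    if "norm h \<le> \<epsilon>" "norm k \<le> \<epsilon>" "\<epsilon> \<le> 1" for a b h k \<epsilon>
  proof -
    let ?wa = "(1 + norm a) powr (- r)" and ?wb = "(1 + norm b) powr (- r)"
    have eps: "0 \<le> \<epsilon>" "norm h \<le> 1" "norm k \<le> 1"
      using that norm_ge_zero[of h] by linarith+
    have "norm (\<psi> (a + h) - \<psi> a) \<le> A' * norm h * ?wa"
      using A'(2) eps by blast
    also have "\<dots> \<le> A' * \<epsilon> * ?wa"
      using that A' by (intro mult_right_mono mult_left_mono) auto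
    finally have 1: "norm (\<psi> (a + h) - \<psi> a) \<le> A' * \<epsilon> * ?wa" .
    have "norm (\<phi> (b + k) - \<phi> b) \<le> B' * norm k * ?wb"
      using B'(2) eps by blast
    also have "\<dots> \<le> B' * \<epsilon> * ?wb"
      using that B' by (intro mult_right_mono mult_left_mono) auto
    finally have 2: "norm (\<phi> (b + k) - \<phi> b) \<le> B' * \<epsilon> * ?wb" .
    have "norm (\<phi> (b + k)) \<le> B * (1 + norm (b + k)) powr (- r)"
      by (rule B)
    also have "\<dots> \<le> B * (2 powr r * ?wb)"
      using eps B assms(3) by (intro mult_left_mono weight_shift) auto
    finally have 3: "norm (\<phi> (b + k)) \<le> B * (2 powr r * ?wb)" .
    have "\<psi> (a + h) * \<phi> (b + k) - \<psi> a * \<phi> b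
        = (\<psi> (a + h) - \<psi> a) * \<phi> (b + k) + \<psi> a * (\<phi> (b + k) - \<phi> b)"
      by (simp add: algebra_simps)
    then have "norm (\<psi> (a + h) * \<phi> (b + k) - \<psi> a * \<phi> b)
        \<le> norm (\<psi> (a + h) - \<psi> a) * norm (\<phi> (b + k)) + norm (\<psi> a) * norm (\<phi> (b + k) - \<phi> b)"
      by (metis norm_mult norm_triangle_ineq)
    also have "\<dots> \<le> (A' * \<epsilon> * ?wa) * (B * (2 powr r * ?wb)) + (A * ?wa) * (B' * \<epsilon> * ?wb)"
      using A A' B B' eps by (intro add_mono mult_mono 1 2 3) auto
    also have "\<dots> = (A' * (B * 2 powr r) + A * B') * \<epsilon> * ?wa * ?wb"
      by (simp add: algebra_simps)
    finally show ?thesis .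
  qed
  moreover have "0 \<le> A' * (B * 2 powr r) + A * B'"
    using A A' B B' by simp
  ultimately show ?thesis by blast
qed

section \<open>The pointwise kernel estimate and its rescaling\<close>

text \<open>
  Since \<open>|x - u| = s |a| \<le> M |a|\<close> for \<open>M = max {s, |u - w|, |v - w|}\<close>, one has
  \<open>|x - w| \<le> M (1 + |a|)\<close>, and likewise for \<open>y\<close>.
\<close>

lemma max_dist_le_mult_weights:
  fixes x y u v w :: "'a::real_normed_vector"
  assumes "0 < s"
  shows "max s (max (norm (x - w)) (norm (y - w)))
    \<le> max s (max (norm (u - w)) (norm (v - w)))
        * ((1 + norm ((1 / s) *\<^sub>R (x - u))) * (1 + norm ((1 / s) *\<^sub>R (y - v))))"
proof -
  define M where "M = max s (max (norm (u - w)) (norm (v - w)))"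
  define a where "a = norm ((1 / s) *\<^sub>R (x - u))"
  define b where "b = norm ((1 / s) *\<^sub>R (y - v))"
  have M: "s \<le> M" "norm (u - w) \<le> M" "norm (v - w) \<le> M" "0 < M"
    using assms by (auto simp: M_def)
  have ab: "0 \<le> a" "0 \<le> b" "norm (x - u) = s * a" "norm (y - v) = s * b"
    using assms by (auto simp: a_def b_def)
  have "norm (x - w) \<le> s * a + M"
    using norm_triangle_ineq[of "x - u" "u - w"] M ab by simp
  also have "\<dots> \<le> M * (1 + a)"
    using M ab mult_right_mono[of s M a] by (simp add: algebra_simps)
  finally have x: "norm (x - w) \<le> M * (1 + a)" .
  have "norm (y - w) \<le> s * b + M"
    using norm_triangle_ineq[of "y - v" "v - w"] M ab by simp
  also have "\<dots> \<le> M * (1 + b)"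
    using M ab mult_right_mono[of s M b] by (simp add: algebra_simps)
  finally have y: "norm (y - w) \<le> M * (1 + b)" .
  have "1 + a \<le> (1 + a) * (1 + b)" "1 + b \<le> (1 + a) * (1 + b)" "1 \<le> (1 + a) * (1 + b)"
    using ab by (simp_all add: algebra_simps)
  then have "M * (1 + a) \<le> M * ((1 + a) * (1 + b))" "M * (1 + b) \<le> M * ((1 + a) * (1 + b))"
      "M * 1 \<le> M * ((1 + a) * (1 + b))"
    using M by (simp_all only: mult_left_mono less_imp_le)
  with x y M show ?thesis
    unfolding M_def[symmetric] a_def[symmetric] b_def[symmetric]
    by (intro max.boundedI) linarith+
qed

text \<open>
  The core of the proof. The function \<open>\<Phi>\<close> stands for a product of two Schwartz functions in the size
  estimate and for a difference of two such products in the Lipschitz estimate. Of its decay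
  exponent \<open>4d + \<delta>\<close>, a part \<open>2d + \<delta>\<close> pays for replacing \<open>(u, v)\<close> by \<open>(x, y)\<close> in the kernel and the
  remaining \<open>2d\<close> makes the integrals over \<open>u\<close> and \<open>v\<close> converge.
\<close>

lemma kernel_bound:
  fixes x y u v w :: "'a::euclidean_space" and h \<Phi> :: complex
  assumes "0 < t" "t < s" "0 < \<eta>" "\<eta> < \<delta>" "0 \<le> C" "0 \<le> B"
    and h: "norm h \<le> C * (t powr \<delta> /
      max s (max (norm (u - w)) (norm (v - w))) powr (2 * real DIM('a) + \<delta>))"
    and \<Phi>: "norm \<Phi> \<le> B * (1 + norm ((1 / s) *\<^sub>R (x - u))) powr (- (4 * real DIM('a) + \<delta>))
                  * (1 + norm ((1 / s) *\<^sub>R (y - v))) powr (- (4 * real DIM('a) + \<delta>))"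
  shows "norm ((1 / s) *\<^sub>R (h * ((1 / s ^ DIM('a) * (1 / s ^ DIM('a))) *\<^sub>R \<Phi>)))
    \<le> C * B * t powr \<delta> * max t (max (norm (x - w)) (norm (y - w))) powr (- (2 * real DIM('a) + \<eta>))
        * envelope (\<delta> - \<eta>) t x y u v s"
proof -
  define p where "p = 2 * real DIM('a) + \<delta>"
  define q where "q = 2 * real DIM('a) + \<eta>"
  define M where "M = max s (max (norm (u - w)) (norm (v - w)))"
  define m where "m = max t (max (norm (x - w)) (norm (y - w)))"
  define a where "a = 1 + norm ((1 / s) *\<^sub>R (x - u))"
  define b where "b = 1 + norm ((1 / s) *\<^sub>R (y - v))"
  define e where "e = a powr (- (2 * real DIM('a))) * b powr (- (2 * real DIM('a)))"
  have pos: "0 < s" "0 < M" "0 < m" "0 < a" "0 < b" "0 \<le> q" "0 \<le> e"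
    using assms by (auto simp: M_def m_def a_def b_def q_def e_def add_pos_nonneg)
  have "max s (max (norm (x - w)) (norm (y - w))) \<le> M * (a * b)"
    unfolding M_def a_def b_def by (rule max_dist_le_mult_weights) fact
  then have sm: "s \<le> M * (a * b)" "m \<le> M * (a * b)"
    using assms(2) by (auto simp: m_def)
  \<comment> \<open>\<open>M a b\<close> dominates both \<open>m\<close> and \<open>s\<close>; the exponent \<open>p = q + (\<delta> - \<eta>)\<close> is shared between them;
    \<open>a\<close> and \<open>b\<close> already include the summand \<open>1\<close>.\<close>
  have "m powr q * s powr (\<delta> - \<eta>) \<le> (M * (a * b)) powr q * (M * (a * b)) powr (\<delta> - \<eta>)"
    using sm pos assms by (intro mult_mono powr_mono2) auto
  also have "\<dots> = (M * (a * b)) powr p"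
    by (simp add: powr_add[symmetric] p_def q_def)
  finally have "inverse ((M * (a * b)) powr p) \<le> inverse (m powr q * s powr (\<delta> - \<eta>))"
    using pos by (intro le_imp_inverse_le) auto
  then have key: "M powr (- p) * (a powr (- p) * b powr (- p)) \<le> m powr (- q) * s powr (- (\<delta> - \<eta>))"
    using pos by (simp add: powr_minus powr_mult del: minus_diff_eq)
  have split_ab: "z powr (- (4 * real DIM('a) + \<delta>)) = z powr (- p) * z powr (- (2 * real DIM('a)))" for z
    by (simp add: powr_add[symmetric] p_def)
  have "norm h * norm \<Phi> \<le> (C * (t powr \<delta> / M powr p)) * (B * (a powr (- p) * b powr (- p)) * e)"
    using h \<Phi> assms pos unfolding split_ab a_def[symmetric] b_def[symmetric] M_def[symmetric] p_def[symmetric] e_def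
    by (intro mult_mono) (auto simp: mult_ac)
  also have "\<dots> = (C * B * t powr \<delta> * e) * (M powr (- p) * (a powr (- p) * b powr (- p)))"
    by (simp add: powr_minus divide_inverse mult_ac)
  also have "\<dots> \<le> (C * B * t powr \<delta> * e) * (m powr (- q) * s powr (- (\<delta> - \<eta>)))"
    using key assms pos by (intro mult_left_mono) auto
  finally have le: "norm h * norm \<Phi> \<le> (C * B * t powr \<delta> * e) * (m powr (- q) * s powr (- (\<delta> - \<eta>)))" .
  have s1: "s powr (- (\<delta> - \<eta>)) * (1 / s) = s powr (- (\<delta> - \<eta>) - 1)"
    using pos by (simp add: powr_diff)
  have env: "envelope (\<delta> - \<eta>) t x y u v s
      = s powr (- (\<delta> - \<eta>)) * (1 / s) * ((1 / s ^ DIM('a)) * (1 / s ^ DIM('a)) * e)"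
    using assms unfolding s1 by (simp add: envelope_def rescaled_weight_def e_def a_def b_def mult_ac)
  have "norm ((1 / s) *\<^sub>R (h * ((1 / s ^ DIM('a) * (1 / s ^ DIM('a))) *\<^sub>R \<Phi>)))
      = (1 / s) * ((1 / s ^ DIM('a)) * (1 / s ^ DIM('a))) * (norm h * norm \<Phi>)"
    using pos by (simp add: norm_mult)
  also have "\<dots> \<le> (1 / s) * ((1 / s ^ DIM('a)) * (1 / s ^ DIM('a)))
      * ((C * B * t powr \<delta> * e) * (m powr (- q) * s powr (- (\<delta> - \<eta>))))"
    using le pos by (intro mult_left_mono) auto
  also have "\<dots> = C * B * t powr \<delta> * m powr (- q) * envelope (\<delta> - \<eta>) t x y u v s"
    unfolding env by (simp only: mult_ac)
  finally show ?thesis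
    unfolding m_def q_def .
qed

text \<open>
  At the point \<open>(w + t x, w + t y)\<close> the maximum is \<open>t \<mu>\<close> with \<open>\<mu> = max {1, |x|, |y|}\<close>, so the powers of
  \<open>t\<close> add up to \<open>2d + \<delta> - (2d + \<eta>) - (\<delta> - \<eta>) = 0\<close>. The factor \<open>3\<close> comes from
  \<open>1 + |(x, y)| \<le> 1 + |x| + |y| \<le> 3 \<mu>\<close>.
\<close>

lemma rescaled_constant_bound:
  fixes X :: "'a::euclidean_space \<times> 'a"
  assumes "0 < t" "0 < \<eta>" "\<eta> < \<delta>" "0 \<le> D"
  shows "t ^ (2 * DIM('a)) * (D * t powr \<delta>
      * max t (max (norm (t *\<^sub>R fst X)) (norm (t *\<^sub>R snd X))) powr (- (2 * real DIM('a) + \<eta>))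
      * (t powr (- (\<delta> - \<eta>)) / (\<delta> - \<eta>)))
    \<le> D * 3 powr (2 * real DIM('a) + \<eta>) / (\<delta> - \<eta>) * (1 + norm X) powr (- (2 * real DIM('a) + \<eta>))"
proof -
  define q where "q = 2 * real DIM('a) + \<eta>"
  define \<mu> where "\<mu> = max 1 (max (norm (fst X)) (norm (snd X)))"
  have q: "0 \<le> q" and \<mu>: "0 < \<mu>" and X: "0 < 1 + norm X"
    using assms by (auto simp: q_def \<mu>_def add_pos_nonneg)
  have "max t (max (norm (t *\<^sub>R fst X)) (norm (t *\<^sub>R snd X))) = t * \<mu>"
    using assms(1) by (simp add: \<mu>_def max_mult_distrib_left)
  then have "t ^ (2 * DIM('a)) * (D * t powr \<delta>
      * max t (max (norm (t *\<^sub>R fst X)) (norm (t *\<^sub>R snd X))) powr (- q) * (t powr (- (\<delta> - \<eta>)) / (\<delta> - \<eta>)))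
    = (t powr (2 * real DIM('a)) * t powr \<delta> * t powr (- q) * t powr (- (\<delta> - \<eta>))) * (D / (\<delta> - \<eta>) * \<mu> powr (- q))"
    using assms(1) \<mu> by (simp add: powr_mult powr_realpow[symmetric])
  also have "t powr (2 * real DIM('a)) * t powr \<delta> * t powr (- q) * t powr (- (\<delta> - \<eta>)) = 1"
    using assms(1) by (simp add: powr_add[symmetric] q_def)
  finally have eq: "t ^ (2 * DIM('a)) * (D * t powr \<delta>
      * max t (max (norm (t *\<^sub>R fst X)) (norm (t *\<^sub>R snd X))) powr (- q) * (t powr (- (\<delta> - \<eta>)) / (\<delta> - \<eta>)))
    = D / (\<delta> - \<eta>) * \<mu> powr (- q)"
    by simp
  have "norm X \<le> norm (fst X) + norm (snd X)"
    by (metis norm_Pair_le prod.collapse)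
  also have "\<dots> \<le> \<mu> + \<mu>"
    by (intro add_mono) (auto simp: \<mu>_def)
  finally have "1 + norm X \<le> 3 * \<mu>"
    unfolding \<mu>_def by linarith
  then have "(1 + norm X) powr q \<le> (3 * \<mu>) powr q"
    using q X by (intro powr_mono2) auto
  then have "(1 + norm X) powr q \<le> 3 powr q * \<mu> powr q"
    by (simp add: powr_mult)
  then have "\<mu> powr (- q) \<le> 3 powr q * (1 + norm X) powr (- q)"
    using X \<mu> by (simp add: powr_minus field_simps)
  then have "D / (\<delta> - \<eta>) * \<mu> powr (- q) \<le> D / (\<delta> - \<eta>) * (3 powr q * (1 + norm X) powr (- q))"
    using assms by (intro mult_left_mono) auto
  then show ?thesis
    unfolding q_def[symmetric] eq by (simp add: mult_ac)
qed

section \<open>The function nu\<close>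

lemma nu_integrand_eq:
  fixes H :: "real^'d \<Rightarrow> real^'d \<Rightarrow> real^'d \<Rightarrow> real \<Rightarrow> real \<Rightarrow> complex"
  shows "nu_integrand H \<psi> \<phi> (w, t) x y u v s
    = H u v w s t * ((1 / s ^ CARD('d) * (1 / s ^ CARD('d))) *\<^sub>R
        (\<psi> ((1 / s) *\<^sub>R (x - u)) * \<phi> ((1 / s) *\<^sub>R (y - v))))"
  by (simp add: nu_integrand_def Sy_def)

text \<open>
  Measurability of the kernel is known only for positive scales. The kernel is therefore replaced
  by its extension by zero, which agrees with it wherever the cutoff \<open>s > t\<close> is nonzero.
\<close>

lemma measurable_nu_integrand:
  fixes H :: "real^'d \<Rightarrow> real^'d \<Rightarrow> real^'d \<Rightarrow> real \<Rightarrow> real \<Rightarrow> complex"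
  assumes H: "(\<lambda>(u, v, w, s, t). H u v w s t)
           \<in> borel_measurable (restrict_space borel (UNIV \<times> UNIV \<times> UNIV \<times> {0<..} \<times> {0<..}))"
    and cont: "continuous_on UNIV \<psi>" "continuous_on UNIV \<phi>" and "0 < t"
    and [measurable]: "f \<in> borel_measurable M" "g \<in> borel_measurable M" "h \<in> borel_measurable M"
  shows "(\<lambda>z. indicator {t<..} (h z) *\<^sub>R ((1 / h z) *\<^sub>R nu_integrand H \<psi> \<phi> (w, t) x y (f z) (g z) (h z)))
    \<in> borel_measurable M"
proof -
  let ?\<Omega> = "UNIV \<times> UNIV \<times> UNIV \<times> {0<..} \<times> {0<..} :: ((real^'d) \<times> (real^'d) \<times> (real^'d) \<times> real \<times> real) set"
  define H0 where "H0 = (\<lambda>z. indicator ?\<Omega> z *\<^sub>R (case z of (u, v, w, s, t) \<Rightarrow> H u v w s t))"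
  have "open ?\<Omega>"
    by (intro open_Times) auto
  then have "?\<Omega> \<inter> space borel \<in> sets borel"
    by (simp del: open_Times)
  from iffD1[OF borel_measurable_restrict_space_iff[OF this] H] have H0: "H0 \<in> borel_measurable borel"
    by (simp only: H0_def)
  have "(\<lambda>z. (f z, g z, w, h z, t)) \<in> M \<rightarrow>\<^sub>M borel"
    unfolding borel_prod[symmetric] by measurable
  then have [measurable]: "(\<lambda>z. H0 (f z, g z, w, h z, t)) \<in> borel_measurable M"
    by (rule measurable_compose[OF _ H0])
  have [measurable]: "\<psi> \<in> borel_measurable borel" "\<phi> \<in> borel_measurable borel"
    using cont by (auto intro: borel_measurable_continuous_onI)
  have "(\<lambda>z. indicator {t<..} (h z) *\<^sub>R ((1 / h z) *\<^sub>R nu_integrand H \<psi> \<phi> (w, t) x y (f z) (g z) (h z)))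
    = (\<lambda>z. indicator {t<..} (h z) *\<^sub>R ((1 / h z) *\<^sub>R
        (H0 (f z, g z, w, h z, t) *
         ((1 / h z ^ CARD('d) * (1 / h z ^ CARD('d))) *\<^sub>R
        (\<psi> ((1 / h z) *\<^sub>R (x - f z)) * \<phi> ((1 / h z) *\<^sub>R (y - g z)))))))"
  proof (rule ext)
    fix z
    show "indicator {t<..} (h z) *\<^sub>R ((1 / h z) *\<^sub>R nu_integrand H \<psi> \<phi> (w, t) x y (f z) (g z) (h z))
      = indicator {t<..} (h z) *\<^sub>R ((1 / h z) *\<^sub>R
        (H0 (f z, g z, w, h z, t) *
         ((1 / h z ^ CARD('d) * (1 / h z ^ CARD('d))) *\<^sub>R
        (\<psi> ((1 / h z) *\<^sub>R (x - f z)) * \<phi> ((1 / h z) *\<^sub>R (y - g z))))))"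
      using \<open>0 < t\<close> by (cases "t < h z") (simp_all add: nu_integrand_eq H0_def)
  qed
  also have "\<dots> \<in> borel_measurable M"
    by measurable
  finally show ?thesis .
qed

text \<open>
  Fubini turns the iterated integral into one integral over \<open>(s, u, v)\<close>, so that differences can be
  taken under a single integral sign.
\<close>

lemma nu_eq_joint_integral:
  assumes "integrable lborel (\<lambda>(s, u, v). indicator {t<..} s *\<^sub>R ((1 / s) *\<^sub>R nu_integrand H \<psi> \<phi> (w, t) x y u v s))"
  shows "nu H \<psi> \<phi> (w, t) (x, y)
    = (LINT (s, u, v)|lborel. indicator {t<..} s *\<^sub>R ((1 / s) *\<^sub>R nu_integrand H \<psi> \<phi> (w, t) x y u v s))"
proof -
  let ?f = "\<lambda>(s, u, v). indicator {t<..} s *\<^sub>R ((1 / s) *\<^sub>R nu_integrand H \<psi> \<phi> (w, t) x y u v s)"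
  have "integrable (lborel \<Otimes>\<^sub>M lborel) ?f"
    using assms by (simp add: lborel_prod)
  then have "(LINT s|lborel. LINT z|lborel. ?f (s, z)) = integral\<^sup>L (lborel \<Otimes>\<^sub>M lborel) ?f"
    by (rule lborel_pair.integral_fst')
  moreover have "(LINT z|lborel. ?f (s, z))
      = indicator {t<..} s *\<^sub>R ((1 / s) *\<^sub>R (LINT (u, v)|lborel. nu_integrand H \<psi> \<phi> (w, t) x y u v s))" for s
    by (simp add: case_prod_unfold)
  ultimately show ?thesis
    by (simp add: nu_def set_lebesgue_integral_def lborel_prod)
qed

theorem lemma2p4:
  fixes H :: "real^'d \<Rightarrow> real^'d \<Rightarrow> real^'d \<Rightarrow> real \<Rightarrow> real \<Rightarrow> complex"
    and \<psi> \<phi> :: "real^'d \<Rightarrow> complex"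
    and \<eta> \<delta> :: real
  assumes "0 < \<eta>" and "\<eta> < \<delta>"
    and "(\<lambda>(u, v, w, s, t). H u v w s t)
           \<in> borel_measurable (restrict_space borel (UNIV \<times> UNIV \<times> UNIV \<times> {0<..} \<times> {0<..}))"
    and "\<exists>C::real. \<forall>u v w s t. 0 < s \<longrightarrow> 0 < t \<longrightarrow>
           norm (H u v w s t)
             \<le> C * (t powr \<delta> / max s (max (norm (u - w)) (norm (v - w))) powr (2 * real CARD('d) + \<delta>))"
    and "schwartz \<psi>" and "schwartz \<phi>"
  shows "(\<forall>w t x y. 0 < t \<longrightarrow>
            set_integrable lborel (UNIV \<times> UNIV \<times> {t<..})
              (\<lambda>(u, v, s). (1 / s) *\<^sub>R nu_integrand H \<psi> \<phi> (w, t) x y u v s)) \<and>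
         (\<exists>K::real. \<forall>w t. 0 < t \<longrightarrow>
            star_norm \<eta> 1 (inv (Sy1 (w, t) \<circ> Sy2 (w, t)) (nu H \<psi> \<phi> (w, t))) \<le> ennreal K)"
proof -
  define n where "n = DIM(real^'d)"
  have n: "n = CARD('d)"
    by (simp add: n_def)
  define r where "r = 4 * real n + \<delta>"
  define q where "q = 2 * real n + \<eta>"
  have r: "0 \<le> r" and \<alpha>: "0 < \<delta> - \<eta>"
    using assms(1,2) by (simp_all add: r_def)
  obtain C0 where C0: "\<And>u v w s t. 0 < s \<Longrightarrow> 0 < t \<Longrightarrow> norm (H u v w s t)
      \<le> C0 * (t powr \<delta> / max s (max (norm (u - w)) (norm (v - w))) powr (2 * real n + \<delta>))"
    using assms(4) unfolding n by blast
  \<comment> \<open>The constant of the hypothesis may be negative a priori.\<close>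
  define C where "C = \<bar>C0\<bar>"
  have C: "0 \<le> C"
    by (simp add: C_def)
  have H_bound: "norm (H u v w s t)
      \<le> C * (t powr \<delta> / max s (max (norm (u - w)) (norm (v - w))) powr (2 * real n + \<delta>))"
    if "0 < s" "0 < t" for u v w s t
    using C0[OF that, of u v w] by (rule order_trans) (unfold C_def, intro mult_right_mono, auto)
  obtain A where A: "0 \<le> A" "\<And>a. norm (\<psi> a) \<le> A * (1 + norm a) powr (- r)"
    using schwartz_decay[OF assms(5)] by metis
  obtain A' where A': "0 \<le> A'" "\<And>a. norm (\<phi> a) \<le> A' * (1 + norm a) powr (- r)"
    using schwartz_decay[OF assms(6)] by metis
  define B where "B = A * A'"
  have B: "0 \<le> B" and B_bound: "norm (\<psi> a * \<phi> b) \<le> B * (1 + norm a) powr (- r) * (1 + norm b) powr (- r)" for a b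
  proof -
    have "norm (\<psi> a * \<phi> b) \<le> (A * (1 + norm a) powr (- r)) * (A' * (1 + norm b) powr (- r))"
      unfolding norm_mult using A A' by (intro mult_mono) auto
    then show "norm (\<psi> a * \<phi> b) \<le> B * (1 + norm a) powr (- r) * (1 + norm b) powr (- r)"
      by (simp add: B_def mult_ac)
  qed (use A A' in \<open>simp add: B_def\<close>)
  obtain L where L: "0 \<le> L" and L_bound: "\<And>a b h k \<epsilon>. norm h \<le> \<epsilon> \<Longrightarrow> norm k \<le> \<epsilon> \<Longrightarrow> \<epsilon> \<le> 1 \<Longrightarrow>
      norm (\<psi> (a + h) * \<phi> (b + k) - \<psi> a * \<phi> b)
        \<le> L * \<epsilon> * (1 + norm a) powr (- r) * (1 + norm b) powr (- r)"
    using schwartz_product_lipschitz_decay[OF assms(5,6) r] by metis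
  define W where "W = (LINT a|(lborel :: (real^'d) measure). (1 + norm a) powr (- (2 * real n)))"
  define g where "g w t x y s u v = indicator {t<..} s *\<^sub>R ((1 / s) *\<^sub>R nu_integrand H \<psi> \<phi> (w, t) x y u v s)"
    for w t x y s u v
  \<comment> \<open>The factor of \<open>kernel_bound\<close> that does not depend on the integration variables.\<close>
  define m where "m w t x y = t powr \<delta> * max t (max (norm (x - w)) (norm (y - w))) powr (- q)"
    for w x y :: "real^'d" and t
  have cont: "continuous_on UNIV \<psi>" "continuous_on UNIV \<phi>"
    using assms(5,6) by (simp_all add: schwartz_imp_continuous)
  note meas = measurable_nu_integrand[OF assms(3) cont, folded g_def]
  have g_bound: "norm (g w t x y s u v) \<le> C * B * m w t x y * envelope (\<delta> - \<eta>) t x y u v s"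
    if t: "0 < t" for w t x y s u v
  proof (cases "t < s")
    case True
    have "norm ((1 / s) *\<^sub>R (H u v w s t * ((1 / s ^ n * (1 / s ^ n)) *\<^sub>R
        (\<psi> ((1 / s) *\<^sub>R (x - u)) * \<phi> ((1 / s) *\<^sub>R (y - v))))))
      \<le> C * B * t powr \<delta> * max t (max (norm (x - w)) (norm (y - w))) powr (- (2 * real n + \<eta>))
        * envelope (\<delta> - \<eta>) t x y u v s"
      using t True unfolding n_def
      by (intro kernel_bound[OF t True assms(1,2) C B] H_bound[unfolded n_def]
          B_bound[unfolded r_def n_def]) simp_all
    with True show ?thesis
      by (simp add: g_def m_def q_def nu_integrand_eq n mult.assoc)
  qed (use t in \<open>simp add: g_def envelope_def\<close>)
  have g_diff_bound: "norm (g w t (x + t *\<^sub>R h) (y + t *\<^sub>R k) s u v - g w t x y s u v)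
      \<le> C * (L * \<epsilon>) * m w t x y * envelope (\<delta> - \<eta>) t x y u v s"
    if t: "0 < t" and hk: "norm h \<le> \<epsilon>" "norm k \<le> \<epsilon>" "\<epsilon> \<le> 1" for w t x y h k \<epsilon> s u v
  proof (cases "t < s")
    case True
    let ?a = "(1 / s) *\<^sub>R (x - u)" and ?b = "(1 / s) *\<^sub>R (y - v)"
    let ?h = "(t / s) *\<^sub>R h" and ?k = "(t / s) *\<^sub>R k"
    have \<epsilon>: "0 \<le> \<epsilon>"
      using hk(1) norm_ge_zero order_trans by blast
    \<comment> \<open>Here \<open>s > t\<close> is used: in the variables at scale \<open>s\<close> the increments shrink.\<close>
    have small: "norm ((t / s) *\<^sub>R z) \<le> \<epsilon>" if "norm z \<le> \<epsilon>" for z :: "real^'d"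
      using mult_mono[of "t / s" 1 "norm z" \<epsilon>] that t True by simp
    have shift: "(1 / s) *\<^sub>R (x + t *\<^sub>R h - u) = ?a + ?h" "(1 / s) *\<^sub>R (y + t *\<^sub>R k - v) = ?b + ?k"
      by (simp_all add: algebra_simps)
    have "norm ((1 / s) *\<^sub>R (H u v w s t * ((1 / s ^ n * (1 / s ^ n)) *\<^sub>R
        (\<psi> (?a + ?h) * \<phi> (?b + ?k) - \<psi> ?a * \<phi> ?b))))
      \<le> C * (L * \<epsilon>) * t powr \<delta> * max t (max (norm (x - w)) (norm (y - w))) powr (- (2 * real n + \<eta>))
        * envelope (\<delta> - \<eta>) t x y u v s"
      using t True L \<epsilon> unfolding n_def
      by (intro kernel_bound[OF t True assms(1,2) C] H_bound[unfolded n_def]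
          L_bound[OF small[OF hk(1)] small[OF hk(2)] hk(3), unfolded r_def n_def]) simp_all
    moreover have "g w t (x + t *\<^sub>R h) (y + t *\<^sub>R k) s u v - g w t x y s u v
        = (1 / s) *\<^sub>R (H u v w s t * ((1 / s ^ n * (1 / s ^ n)) *\<^sub>R
        (\<psi> (?a + ?h) * \<phi> (?b + ?k) - \<psi> ?a * \<phi> ?b)))"
      using True unfolding g_def nu_integrand_eq shift
      by (simp add: n scaleR_diff_right right_diff_distrib)
    ultimately show ?thesis
      by (simp add: m_def q_def mult.assoc)
  qed (use t in \<open>simp add: g_def envelope_def\<close>)
  note env = integral_envelope[OF \<alpha>, where 'a = "real^'d", folded n_def, folded W_def]
  have int1: "integrable lborel (\<lambda>(s, u, v). g w t x y s u v)" if t: "0 < t" for w t x y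
  proof (rule Bochner_Integration.integrable_bound)
    show "integrable lborel (\<lambda>z. (C * B * m w t x y) * (case z of (s, u, v) \<Rightarrow> envelope (\<delta> - \<eta>) t x y u v s))"
      using env(1)[OF t] by (rule integrable_mult_right)
    have "(\<lambda>(s, u, v). g w t x y s u v) \<in> borel_measurable borel"
      unfolding borel_prod[symmetric] case_prod_beta
      by (rule meas[OF t]) measurable
    then show "(\<lambda>(s, u, v). g w t x y s u v) \<in> borel_measurable lborel"
      by simp
  qed (use g_bound[OF t] in \<open>auto intro!: AE_I2 order_trans[OF _ abs_ge_self]\<close>)
  have int2: "integrable lborel (\<lambda>(u, v, s). g w t x y s u v)" if t: "0 < t" for w t x y
  proof (rule Bochner_Integration.integrable_bound)
    show "integrable lborel (\<lambda>z. (C * B * m w t x y) * (case z of (u, v, s) \<Rightarrow> envelope (\<delta> - \<eta>) t x y u v s))"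
      using env(2)[OF t] by (rule integrable_mult_right)
    have "(\<lambda>(u, v, s). g w t x y s u v) \<in> borel_measurable borel"
      unfolding borel_prod[symmetric] case_prod_beta
      by (rule meas[OF t]) measurable
    then show "(\<lambda>(u, v, s). g w t x y s u v) \<in> borel_measurable lborel"
      by simp
  qed (use g_bound[OF t] in \<open>auto intro!: AE_I2 order_trans[OF _ abs_ge_self]\<close>)
  have nu: "nu H \<psi> \<phi> (w, t) (x, y) = (LINT (s, u, v)|lborel. g w t x y s u v)" if "0 < t" for w t x y
    using nu_eq_joint_integral[of t H \<psi> \<phi> w x y, folded g_def] int1[OF that] by simp
  have dominated: "norm (\<integral>z. F z \<partial>lborel) \<le> D * (W\<^sup>2 * (t powr (- (\<delta> - \<eta>)) / (\<delta> - \<eta>)))"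
    if "0 < t" "integrable lborel F" "\<And>s u v. norm (F (s, u, v)) \<le> D * envelope (\<delta> - \<eta>) t x y u v s"
    for F :: "real \<times> (real^'d) \<times> (real^'d) \<Rightarrow> complex" and D t x y
  proof -
    have "norm (\<integral>z. F z \<partial>lborel) \<le> (\<integral>z. D * (case z of (s, u, v) \<Rightarrow> envelope (\<delta> - \<eta>) t x y u v s) \<partial>lborel)"
      using that env(1)[OF that(1)]
      by (intro Bochner_Integration.integral_norm_bound_integral integrable_mult_right) auto
    then show ?thesis
      using env(3)[OF that(1)] by simp
  qed
  define G where "G w t = inv (Sy1 (w, t) \<circ> Sy2 (w, t)) (nu H \<psi> \<phi> (w, t))" for w t
  have G: "G w t X = t ^ (2 * n) *\<^sub>R nu H \<psi> \<phi> (w, t) (w + t *\<^sub>R fst X, w + t *\<^sub>R snd X)"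
    if "0 < t" for w t X
    unfolding G_def n bij_Sy1_Sy2(2)[OF that] by (simp add: case_prod_beta)
  define K where "K = C * W\<^sup>2 * 3 powr q / (\<delta> - \<eta>)"
  have K: "0 \<le> K"
    using C \<alpha> by (simp add: K_def)
  have scaled: "t ^ (2 * n) * (C * D * m w t (w + t *\<^sub>R fst X) (w + t *\<^sub>R snd X) * (W\<^sup>2 * (t powr (- (\<delta> - \<eta>)) / (\<delta> - \<eta>))))
      \<le> K * D * (1 + norm X) powr (- q)" if "0 < t" "0 \<le> D" for t w X D
    using rescaled_constant_bound[OF that(1) assms(1,2), of "C * D * W\<^sup>2" X] that(2) C
    by (simp add: m_def K_def q_def n mult_ac)
  have cancel: "(1 + norm X) powr q * b \<le> c" if "b \<le> c * (1 + norm X) powr (- q)"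
    for X :: "(real^'d) \<times> (real^'d)" and b c :: real
  proof -
    have "(1 + norm X) powr q * b \<le> (1 + norm X) powr q * (c * (1 + norm X) powr (- q))"
      using that by (intro mult_left_mono) auto
    also have "\<dots> = c * ((1 + norm X) powr q * (1 + norm X) powr (- q))"
      by (simp only: mult_ac)
    also have "(1 + norm X) powr q * (1 + norm X) powr (- q) = 1"
      using norm_ge_zero[of X] by (simp add: powr_add[symmetric] add_nonneg_eq_0_iff)
    finally show ?thesis by simp
  qed
  have size: "(1 + norm X) powr q * norm (G w t X) \<le> K * B" if t: "0 < t" for w t X
  proof (rule cancel)
    let ?x = "w + t *\<^sub>R fst X" and ?y = "w + t *\<^sub>R snd X"
    have nu_le: "norm (nu H \<psi> \<phi> (w, t) (?x, ?y)) \<le> C * B * m w t ?x ?y * (W\<^sup>2 * (t powr (- (\<delta> - \<eta>)) / (\<delta> - \<eta>)))"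
      unfolding nu[OF t] using g_bound[OF t]
      by (intro dominated[where x = ?x and y = ?y] t int1) auto
    have "norm (G w t X) \<le> t ^ (2 * n) * (C * B * m w t ?x ?y * (W\<^sup>2 * (t powr (- (\<delta> - \<eta>)) / (\<delta> - \<eta>))))"
      using t unfolding G[OF t] norm_scaleR by (intro mult_mono nu_le) simp_all
    also have "\<dots> \<le> K * B * (1 + norm X) powr (- q)"
      by (rule scaled) fact+
    finally show "norm (G w t X) \<le> K * B * (1 + norm X) powr (- q)" .
  qed
  have lipschitz: "(1 + norm X) powr q * (norm (G w t (X + h) - G w t X) / norm h powr 1) \<le> K * L"
    if t: "0 < t" and h: "0 < norm h" "norm h \<le> 1" for w t X h
  proof (rule cancel)
    let ?x = "w + t *\<^sub>R fst X" and ?y = "w + t *\<^sub>R snd X"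
    let ?x' = "?x + t *\<^sub>R fst h" and ?y' = "?y + t *\<^sub>R snd h"
    have hk: "norm (fst h) \<le> norm h" "norm (snd h) \<le> norm h"
      by (metis norm_fst_le norm_snd_le prod.collapse)+
    have "nu H \<psi> \<phi> (w, t) (?x', ?y') - nu H \<psi> \<phi> (w, t) (?x, ?y)
        = (\<integral>z. (case z of (s, u, v) \<Rightarrow> g w t ?x' ?y' s u v) - (case z of (s, u, v) \<Rightarrow> g w t ?x ?y s u v) \<partial>lborel)"
      unfolding nu[OF t] by (intro Bochner_Integration.integral_diff[symmetric] int1 t)
    also have "norm \<dots> \<le> C * (L * norm h) * m w t ?x ?y * (W\<^sup>2 * (t powr (- (\<delta> - \<eta>)) / (\<delta> - \<eta>)))"
      using g_diff_bound[OF t hk h(2)]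
      by (intro dominated[where x = ?x and y = ?y] t Bochner_Integration.integrable_diff int1) auto
    finally have diff_le: "norm (nu H \<psi> \<phi> (w, t) (?x', ?y') - nu H \<psi> \<phi> (w, t) (?x, ?y))
        \<le> C * (L * norm h) * m w t ?x ?y * (W\<^sup>2 * (t powr (- (\<delta> - \<eta>)) / (\<delta> - \<eta>)))" .
    have G_diff: "G w t (X + h) - G w t X
        = t ^ (2 * n) *\<^sub>R (nu H \<psi> \<phi> (w, t) (?x', ?y') - nu H \<psi> \<phi> (w, t) (?x, ?y))"
      unfolding G[OF t] by (simp add: scaleR_diff_right scaleR_add_right add.assoc)
    have "norm (G w t (X + h) - G w t X)
        \<le> t ^ (2 * n) * (C * (L * norm h) * m w t ?x ?y * (W\<^sup>2 * (t powr (- (\<delta> - \<eta>)) / (\<delta> - \<eta>))))"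
      using t unfolding G_diff norm_scaleR by (intro mult_mono diff_le) simp_all
    also have "\<dots> \<le> K * (L * norm h) * (1 + norm X) powr (- q)"
      using t L by (intro scaled) auto
    finally show "norm (G w t (X + h) - G w t X) / norm h powr 1 \<le> K * L * (1 + norm X) powr (- q)"
      using h by (simp add: field_simps)
  qed
  have star: "star_norm \<eta> 1 (G w t) \<le> ennreal (K * B + K * L)" if t: "0 < t" for w t
  proof -
    have "star_norm \<eta> 1 (G w t) \<le> ennreal (K * B) + ennreal (K * L)"
      unfolding star_norm_def
      using size[OF t] lipschitz[OF t]
      by (intro add_mono SUP_least) (auto simp: q_def n intro!: ennreal_leI)
    then show ?thesis
      using K B L by simp
  qed
  have set_int: "set_integrable lborel (UNIV \<times> UNIV \<times> {t<..})
      (\<lambda>(u, v, s). (1 / s) *\<^sub>R nu_integrand H \<psi> \<phi> (w, t) x y u v s)" if "0 < t" for w t x y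
  proof -
    have "(\<lambda>z. indicator (UNIV \<times> UNIV \<times> {t<..}) z *\<^sub>R
          (case z of (u, v, s) \<Rightarrow> (1 / s) *\<^sub>R nu_integrand H \<psi> \<phi> (w, t) x y u v s))
        = (\<lambda>(u, v, s). g w t x y s u v)"
      by (auto simp: g_def fun_eq_iff split: split_indicator)
    with int2[OF that, of w x y] show ?thesis
      unfolding set_integrable_def by simp
  qed
  show ?thesis
    by (intro conjI allI impI exI[of _ "K * B + K * L"] set_int star[unfolded G_def])
qed

end
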